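(* Every countable partial order can be represented by finite graphs with the relation $\prec_{cc}$: for every countable partially ordered set $(P,\le)$ there is an injective assignment $x\mapsto G_x$ of finite graphs to the elements of $P$ such that for all $x,y\in P$, $$x<y\iff G_x\prec_{cc}G_y .$$
   Context: Graphs are finite, undirected and loopless. A cut in a graph $G=(V,E)$ is the set of all edges with one end in $X$ and the other in $V\setminus X$, for some $X\subseteq V$ (so the empty set is a cut). A mapping $f:E(G)\to E(H)$ is cut-continuous if for every cut $C$ of $H$ the preimage $f^{-1}(C)$ is a cut of $G$. Write $G\preccurlyeq_{cc}H$ if there is a cut-continuous mapping $E(G)\to E(H)$, and $G\prec_{cc}H$ if $G\preccurlyeq_{cc}H$ but not $H\preccurlyeq_{cc}G$. *)

theory Defs
  imports Main "HOL-Library.Countable_Set" "HOL-Library.FuncSet"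
begin

text \<open>
  Undirected graphs; edges are objects of their own, so parallel edges are possible.
  Only the values of \<open>ends\<close> on \<open>edges\<close> matter.
\<close>

record ('v, 'e) graph =
  verts :: "'v set"
  edges :: "'e set"
  ends :: "'e \<Rightarrow> 'v set"

text \<open>The cardinality condition on the set of ends excludes loops.\<close>

definition finite_loopless_graph :: "('v, 'e) graph \<Rightarrow> bool" where
  "finite_loopless_graph G \<longleftrightarrow>
     finite (verts G) \<and> finite (edges G) \<and>
     (\<forall>e \<in> edges G. ends G e \<subseteq> verts G \<and> card (ends G e) = 2)"

definition graph_iso :: "('v, 'e) graph \<Rightarrow> ('w, 'f) graph \<Rightarrow> bool" where
  "graph_iso G H \<longleftrightarrow>
     (\<exists>\<phi> \<psi>. bij_betw \<phi> (verts G) (verts H) \<and> bij_betw \<psi> (edges G) (edges H) \<and>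
            (\<forall>e \<in> edges G. ends H (\<psi> e) = \<phi> ` ends G e))"

definition edge_boundary :: "('v, 'e) graph \<Rightarrow> 'v set \<Rightarrow> 'e set" where
  "edge_boundary G X =
     {e \<in> edges G. \<exists>u v. ends G e = {u, v} \<and> u \<in> X \<and> v \<in> verts G - X}"

definition is_cut :: "('v, 'e) graph \<Rightarrow> 'e set \<Rightarrow> bool" where
  "is_cut G C \<longleftrightarrow> (\<exists>X \<subseteq> verts G. C = edge_boundary G X)"

definition cut_continuous ::
  "('v, 'e) graph \<Rightarrow> ('w, 'f) graph \<Rightarrow> ('e \<Rightarrow> 'f) \<Rightarrow> bool" where
  "cut_continuous G H f \<longleftrightarrow>
     f \<in> edges G \<rightarrow> edges H \<and>
     (\<forall>C. is_cut H C \<longrightarrow> is_cut G {e \<in> edges G. f e \<in> C})"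

definition cc_le :: "('v, 'e) graph \<Rightarrow> ('w, 'f) graph \<Rightarrow> bool"
    (infix "\<preceq>cc" 50) where
  "G \<preceq>cc H \<longleftrightarrow> (\<exists>f. cut_continuous G H f)"

definition cc_less :: "('v, 'e) graph \<Rightarrow> ('w, 'f) graph \<Rightarrow> bool"
    (infix "\<prec>cc" 50) where
  "G \<prec>cc H \<longleftrightarrow> G \<preceq>cc H \<and> \<not> H \<preceq>cc G"

end

theory Submission
  imports Defs "HOL-Library.Nat_Bijection" "HOL-Computational_Algebra.Primes"
begin

text \<open>
  A cut-continuous map \<open>E(G) \<rightarrow> E(H)\<close> yields a map \<open>g\<close> from \<open>V(G)\<close> to sets of vertices of \<open>H\<close> such that
  adjacent \<open>u\<close> and \<open>v\<close> have \<open>g u \<triangle> g v\<close> the two ends of an edge. If \<open>G\<close> is a cone with five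
  apexes, pairwise adjacent and joined to all other vertices, then \<open>g u = A \<triangle> {h u}\<close> for a fixed
  \<open>A\<close>, so that \<open>h\<close> is a graph homomorphism \<open>G \<rightarrow> H\<close>. We use cones over the circulants \<open>X\<^sub>n\<close> on
  \<open>\<int>/n\<close> with steps \<open>\<plusminus>1, \<plusminus>4, \<plusminus>15\<close>. Homomorphisms between these cones preserve the apexes, and the
  only homomorphisms \<open>X\<^sub>n \<rightarrow> X\<^sub>m\<close> for large \<open>n, m\<close> are \<open>i \<mapsto> c \<plusminus> i\<close>, so they exist iff \<open>m dvd n\<close>.
  For disjoint unions over finite sets \<open>M\<close>, \<open>M'\<close> of moduli, \<open>\<preceq>cc\<close> therefore means that every member
  of \<open>M\<close> has a divisor in \<open>M'\<close>; every countable partial order embeds into this order of finite sets.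
\<close>

section \<open>Cuts and potentials\<close>

lemma edge_boundary_iff:
  assumes "e \<in> edges G" "ends G e = {u, v}" "u \<in> verts G" "v \<in> verts G"
  shows "e \<in> edge_boundary G X \<longleftrightarrow> (u \<in> X) \<noteq> (v \<in> X)"
  using assms unfolding edge_boundary_def by (auto simp: doubleton_eq_iff)

text \<open>The preimage of the cut around a vertex \<open>w\<close> is the boundary of some
  \<open>X w\<close>; \<open>g u\<close> collects the \<open>w\<close> with
  \<open>u \<in> X w\<close>. Hence \<open>w\<close> separates \<open>g u\<close> from
  \<open>g v\<close> iff it is an end of \<open>f e\<close>.\<close>

lemma cut_continuous_potential:
  assumes cc: "cut_continuous G H f"
    and G: "finite_loopless_graph G" and H: "finite_loopless_graph H"
  obtains g where
    "\<And>e u v. e \<in> edges G \<Longrightarrow> ends G e = {u, v} \<Longrightarrow> sym_diff (g u) (g v) = ends H (f e)"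
proof -
  have f: "f \<in> edges G \<rightarrow> edges H"
    using cc by (simp add: cut_continuous_def)
  have "\<exists>X. {e \<in> edges G. f e \<in> edge_boundary H {w}} = edge_boundary G X"
    if "w \<in> verts H" for w
  proof -
    have "is_cut H (edge_boundary H {w})"
      using that unfolding is_cut_def by blast
    then show ?thesis
      using cc unfolding cut_continuous_def is_cut_def by blast
  qed
  then obtain X where X:
    "\<And>w. w \<in> verts H \<Longrightarrow> {e \<in> edges G. f e \<in> edge_boundary H {w}} = edge_boundary G (X w)"
    by metis
  define g where "g u = {w \<in> verts H. u \<in> X w}" for u
  show thesis
  proof
    fix e u v assume e: "e \<in> edges G" and uv: "ends G e = {u, v}"
    have uvV: "u \<in> verts G" "v \<in> verts G"
      using G e uv by (auto simp: finite_loopless_graph_def)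
    have fe: "f e \<in> edges H" using f e by blast
    then have "card (ends H (f e)) = 2" and sub: "ends H (f e) \<subseteq> verts H"
      using H by (auto simp: finite_loopless_graph_def)
    then obtain p q where pq: "ends H (f e) = {p, q}" "p \<noteq> q"
      by (auto simp: card_2_iff)
    have "w \<in> sym_diff (g u) (g v) \<longleftrightarrow> w \<in> {p, q}" for w
    proof (cases "w \<in> verts H")
      case True
      have "w \<in> sym_diff (g u) (g v) \<longleftrightarrow> (u \<in> X w) \<noteq> (v \<in> X w)"
        using True by (auto simp: g_def)
      also have "\<dots> \<longleftrightarrow> e \<in> edge_boundary G (X w)"
        using edge_boundary_iff[OF e uv uvV] by simp
      also have "\<dots> \<longleftrightarrow> f e \<in> edge_boundary H {w}"
        using X[OF True] e by blast
      also have "\<dots> \<longleftrightarrow> (p \<in> {w}) \<noteq> (q \<in> {w})"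
        using edge_boundary_iff[OF fe pq(1)] sub pq(1) by simp
      also have "\<dots> \<longleftrightarrow> w \<in> {p, q}" using pq(2) by auto
      finally show ?thesis .
    next
      case False
      then show ?thesis using sub pq(1) by (auto simp: g_def)
    qed
    then show "sym_diff (g u) (g v) = ends H (f e)" unfolding pq(1) by blast
  qed
qed

section \<open>Families of sets at pairwise distance two\<close>

lemma two_sets_meet:
  assumes "card (sym_diff A B) = 2" "card A = 2" "card B = 2"
  obtains c a b where "A = {c, a}" "B = {c, b}" "a \<noteq> b" "a \<noteq> c" "b \<noteq> c"
proof -
  obtain p q where A: "A = {p, q}" "p \<noteq> q" using assms(2) by (auto simp: card_2_iff)
  obtain r s where B: "B = {r, s}" "r \<noteq> s" using assms(3) by (auto simp: card_2_iff)
  have False if "A \<inter> B = {}"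
  proof -
    have "sym_diff A B = {p, q, r, s}" "card {p, q, r, s} = 4"
      using that A B by auto
    then show False using assms(1) by simp
  qed
  then have "p = r \<or> p = s \<or> q = r \<or> q = s" using A B by auto
  moreover have "A \<noteq> B" using assms(1) by auto
  ultimately show thesis using A B that by (metis insert_commute)
qed

lemma two_sets_meet_iff:
  assumes "card (sym_diff D {c, a}) = 2" "card D = 2" "a \<noteq> c"
  shows "(c \<in> D) \<noteq> (a \<in> D)"
proof -
  have "card {c, a} = 2" using assms(3) by simp
  then obtain c' d b where "D = {c', d}" "{c, a} = {c', b}" "d \<noteq> b" "d \<noteq> c'" "b \<noteq> c'"
    by (rule two_sets_meet[OF assms(1,2)])
  then show ?thesis by (auto simp: doubleton_eq_iff)
qed

text \<open>Pairs that share one point with each other form a star or a triangle; a triangle has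
  only three members, so four pairs have a common point, and any further pair meeting them all
  contains it.\<close>

lemma star_of_two_sets:
  fixes D :: "nat \<Rightarrow> 'b set"
  assumes two: "\<And>i. i < 4 \<Longrightarrow> card (D i) = 2"
    and meet: "\<And>i j. i < 4 \<Longrightarrow> j < 4 \<Longrightarrow> i \<noteq> j \<Longrightarrow> card (sym_diff (D i) (D j)) = 2"
  obtains c where "\<And>i. i < 4 \<Longrightarrow> c \<in> D i"
    and "\<And>C. card C = 2 \<Longrightarrow> (\<And>i. i < 4 \<Longrightarrow> card (sym_diff C (D i)) = 2) \<Longrightarrow> c \<in> C"
proof -
  obtain c a b where D01: "D 0 = {c, a}" "D 1 = {c, b}" and ne: "a \<noteq> b" "a \<noteq> c" "b \<noteq> c"
    by (rule two_sets_meet[of "D 0" "D 1"]) (use two meet in auto)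
  have meets: "(c \<in> C) \<noteq> (a \<in> C)" "(c \<in> C) \<noteq> (b \<in> C)"
    if "card C = 2" "card (sym_diff C (D 0)) = 2" "card (sym_diff C (D 1)) = 2" for C
    using two_sets_meet_iff[OF _ that(1) ne(2)] two_sets_meet_iff[OF _ that(1) ne(3)] that(2,3)
    unfolding D01 by blast+
  have ab: "C = {a, b}"
    if "c \<notin> C" "card C = 2" "card (sym_diff C (D 0)) = 2" "card (sym_diff C (D 1)) = 2" for C
  proof -
    have "a \<in> C" "b \<in> C" using meets[OF that(2-)] that(1) by blast+
    moreover obtain p q where "C = {p, q}" using \<open>card C = 2\<close> by (meson card_2_iff)
    ultimately show ?thesis using ne(1) by blast
  qed
  \<comment> \<open>If \<open>c\<close> is missing, \<open>C\<close> is \<open>{a, b}\<close>; then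
    \<open>E\<close> contains \<open>c\<close>, hence avoids \<open>a\<close> and \<open>b\<close>,
    and is disjoint from \<open>C\<close>.\<close>
  have step: "c \<in> C" if C: "card C = 2" "card (sym_diff C (D 0)) = 2" "card (sym_diff C (D 1)) = 2"
    and E: "card E = 2" "card (sym_diff E (D 0)) = 2" "card (sym_diff E (D 1)) = 2"
    and CE: "card (sym_diff C E) = 2" for C E
  proof (rule ccontr)
    assume "c \<notin> C"
    then have Cab: "C = {a, b}" using ab C by blast
    have "E \<noteq> C" using CE by force
    then have "c \<in> E" using ab[OF _ E] Cab by blast
    then have "a \<notin> E" "b \<notin> E" using meets[OF E] by blast+
    then have disj: "C \<inter> E = {}" using Cab by blast
    have "finite C" "finite E" using C(1) E(1) by (metis card.infinite zero_neq_numeral)+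
    then have "card (C \<union> E) = 4" using disj C(1) E(1) by (simp add: card_Un_disjoint)
    moreover have "sym_diff C E = C \<union> E" using disj by blast
    ultimately show False using CE by simp
  qed
  have c23: "c \<in> D 2" "c \<in> D 3"
    using step[of "D 2" "D 3"] step[of "D 3" "D 2"] two meet by simp_all
  show thesis
  proof
    show "c \<in> D i" if "i < 4" for i
    proof -
      have "i = 0 \<or> i = 1 \<or> i = 2 \<or> i = 3" using that by auto
      then show ?thesis using D01 c23 by auto
    qed
    show "c \<in> C" if "card C = 2" "\<And>i. i < 4 \<Longrightarrow> card (sym_diff C (D i)) = 2" for C
      using step[of C "D 2"] that two meet by simp
  qed
qed

text \<open>Translation by \<open>B 4\<close> turns the other four sets into pairs with a common
  point \<open>c\<close>; changing \<open>B 4\<close> at \<open>c\<close> gives \<open>A\<close>.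
  With only four sets the three translates could form a triangle.\<close>

lemma five_clique_star:
  fixes B :: "nat \<Rightarrow> 'b set"
  assumes B: "\<And>i j. i < 5 \<Longrightarrow> j < 5 \<Longrightarrow> i \<noteq> j \<Longrightarrow> card (sym_diff (B i) (B j)) = 2"
  obtains A where "\<And>i. i < 5 \<Longrightarrow> \<exists>h. sym_diff A (B i) = {h}"
    and "\<And>C. (\<And>i. i < 5 \<Longrightarrow> card (sym_diff C (B i)) = 2) \<Longrightarrow> \<exists>h. sym_diff A C = {h}"
proof -
  let ?D = "\<lambda>i. sym_diff (B 4) (B i)"
  have cancel: "sym_diff (sym_diff Z X) (sym_diff Z Y) = sym_diff X Y" for X Y Z :: "'b set"
    by auto
  have two: "card (?D i) = 2" if "i < 4" for i
    using B[of 4 i] that by simp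
  have meet: "card (sym_diff (?D i) (?D j)) = 2" if "i < 4" "j < 4" "i \<noteq> j" for i j
    unfolding cancel using B[of i j] that by simp
  obtain c where c: "\<And>i. i < 4 \<Longrightarrow> c \<in> ?D i"
    and cC: "\<And>C. card C = 2 \<Longrightarrow> (\<And>i. i < 4 \<Longrightarrow> card (sym_diff C (?D i)) = 2) \<Longrightarrow> c \<in> C"
    using star_of_two_sets[of ?D, OF two meet] by blast
  have single: "\<exists>h. sym_diff (sym_diff (B 4) {c}) C = {h}"
    if C: "card (sym_diff (B 4) C) = 2" "c \<in> sym_diff (B 4) C" for C
  proof -
    obtain p q where pq: "sym_diff (B 4) C = {p, q}" "p \<noteq> q"
      using C(1) unfolding card_2_iff by blast
    have "c \<in> {p, q}" using C(2) unfolding pq(1) .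
    then obtain h where "{p, q} = {c, h}" and hc: "h \<noteq> c"
      using pq(2) by (metis insertE insert_commute singletonD)
    then have h: "sym_diff (B 4) C = {c, h}" unfolding pq(1) by simp
    have "sym_diff (sym_diff (B 4) {c}) C = sym_diff (sym_diff (B 4) C) {c}" by auto
    also have "\<dots> = {h}" unfolding h using hc by auto
    finally show ?thesis by blast
  qed
  show thesis
  proof (rule that[of "sym_diff (B 4) {c}"])
    show "\<exists>h. sym_diff (sym_diff (B 4) {c}) (B i) = {h}" if "i < 5" for i
    proof (cases "i = 4")
      case True
      have "sym_diff (sym_diff (B 4) {c}) (B 4) = {c}" by auto
      then show ?thesis using True by blast
    next
      case False
      then show ?thesis using single[of "B i"] c[of i] B[of 4 i] that by simp
    qed
    show "\<exists>h. sym_diff (sym_diff (B 4) {c}) C = {h}"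
      if C: "\<And>i. i < 5 \<Longrightarrow> card (sym_diff C (B i)) = 2" for C
    proof -
      have "card (sym_diff (B 4) C) = 2" using C[of 4] by (simp add: Un_commute)
      moreover have "card (sym_diff (sym_diff (B 4) C) (?D i)) = 2" if "i < 4" for i
        unfolding cancel using C[of i] that by simp
      ultimately show ?thesis using single cC by blast
    qed
  qed
qed

section \<open>Rigidity of walks with circulant steps\<close>

text \<open>With 1 and 4 alone the periodic walk 1, 1, 1, -4 would be possible, since all its
  four-term sums are -1; the step 15 excludes it.\<close>

definition steps :: "int set" where
  "steps = {1, -1, 4, -4, 15, -15}"

lemma steps_uminus: "s \<in> steps \<Longrightarrow> - s \<in> steps"
  by (auto simp: steps_def)

lemma steps_abs_le: "s \<in> steps \<Longrightarrow> \<bar>s\<bar> \<le> 15"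
  by (auto simp: steps_def)

lemma steps_triangle_free:
  assumes "a \<in> steps" "b \<in> steps" "c \<in> steps" shows "a + b + c \<noteq> 0"
  using assms unfolding steps_def by auto

text \<open>
  Along \<open>i, i + 1, \<dots>, i + 4\<close> the steps of a homomorphism thus are \<open>e, e, e, e\<close> or a permutation
  of \<open>e, e, e, -4 e\<close>.
\<close>

lemma steps_four_window:
  assumes "a \<in> steps" "b \<in> steps" "c \<in> steps" "d \<in> steps" "a + b + c + d \<in> steps"
  shows "\<exists>e\<in>{1, -1}. {a, b, c, d} \<subseteq> {e, -4 * e} \<and> a + b + c + d \<in> {4 * e, -e}"
proof -
  have "a + b + c + d = 1 \<or> a + b + c + d = -1 \<or> a + b + c + d = 4 \<or> a + b + c + d = -4
    \<or> a + b + c + d = 15 \<or> a + b + c + d = -15"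
    using assms(5) by (auto simp: steps_def)
  then show ?thesis
    using assms(1-4) unfolding steps_def by (elim insertE emptyE) simp_all
qed

text \<open>
  The step 15 excludes \<open>-4 e\<close>: fifteen consecutive steps contain at most four such terms, say \<open>j\<close>,
  and their sum \<open>(15 - 5 j) e\<close> is an admitted step only for \<open>j = 0\<close>.
\<close>

lemma steps_rigid:
  assumes d: "\<And>k. d k \<in> steps"
    and four: "\<And>k. d k + d (Suc k) + d (k + 2) + d (k + 3) \<in> steps"
    and fifteen: "\<And>k. (\<Sum>i<15. d (k + i)) \<in> steps"
  obtains e where "e \<in> {1, -1}" "\<And>k. d k = e"
proof -
  let ?w = "\<lambda>k. d k + d (Suc k) + d (k + 2) + d (k + 3)"
  have "\<exists>e\<in>{1, -1}. {d k, d (Suc k), d (k + 2), d (k + 3)} \<subseteq> {e, -4 * e} \<and> ?w k \<in> {4 * e, -e}"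
    for k
    using steps_four_window[OF d d d d four[of k]] .
  then obtain \<epsilon> where \<epsilon>: "\<And>k. \<epsilon> k \<in> {1, -1}"
    and de: "\<And>k. {d k, d (Suc k), d (k + 2), d (k + 3)} \<subseteq> {\<epsilon> k, -4 * \<epsilon> k}"
    and we: "\<And>k. ?w k \<in> {4 * \<epsilon> k, - \<epsilon> k}"
    by metis
  \<comment> \<open>Consecutive windows share \<open>d (Suc k)\<close>, and \<open>{1, -4}\<close>
    is disjoint from \<open>{-1, 4}\<close>.\<close>
  have "\<epsilon> (Suc k) = \<epsilon> k" for k
  proof -
    have "d (Suc k) \<in> {\<epsilon> k, -4 * \<epsilon> k}" "d (Suc k) \<in> {\<epsilon> (Suc k), -4 * \<epsilon> (Suc k)}"
      using de[of k] de[of "Suc k"] by blast+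
    then show ?thesis
      using \<epsilon>[of k] \<epsilon>[of "Suc k"] by (elim insertE emptyE; linarith)
  qed
  then have const: "\<epsilon> k = \<epsilon> 0" for k
    by (induction k) auto
  define e where "e = \<epsilon> 0"
  have e: "e \<in> {1, -1}" and dk: "d k \<in> {e, -4 * e}" and wk: "?w k \<in> {4 * e, - e}" for k
    using \<epsilon>[of 0] de[of k] we[of k] unfolding const[of k] e_def by blast+
  have "d k = e" for k
  proof -
    \<comment> \<open>Fifteen terms are three windows and a rest of three; the window starting at
      \<open>k + 11\<close> covers the rest and shows that it contains at most one
      \<open>-4 * e\<close>.\<close>
    let ?t = "d (k + 12) + d (k + 13) + d (k + 14)"
    have "(\<Sum>i<15. d (k + i)) = ?w k + ?w (k + 4) + ?w (k + 8) + ?t"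
      by (simp add: eval_nat_numeral)
    then have S: "?w k + ?w (k + 4) + ?w (k + 8) + ?t \<in> steps"
      using fifteen[of k] by simp
    have "?w (k + 11) = d (k + 11) + ?t"
      by (simp add: eval_nat_numeral)
    then have w: "d (k + 11) + ?t \<in> {4 * e, -e}"
      using wk by metis
    have "y + z + u \<in> {3 * e, -2 * e}"
      if "x \<in> {e, -4 * e}" "y \<in> {e, -4 * e}" "z \<in> {e, -4 * e}" "u \<in> {e, -4 * e}"
        "x + (y + z + u) \<in> {4 * e, -e}" for x y z u
      using that e by auto
    then have t: "?t \<in> {3 * e, -2 * e}"
      using dk dk dk dk w .
    have "x = 4 * e"
      if "x \<in> {4 * e, -e}" "y \<in> {4 * e, -e}" "z \<in> {4 * e, -e}" "u \<in> {3 * e, -2 * e}"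
        "x + y + z + u \<in> steps" for x y z u
      using that e unfolding steps_def by auto
    then have "?w k = 4 * e"
      using wk wk wk t S .
    moreover have "x = e"
      if "x \<in> {e, -4 * e}" "y \<in> {e, -4 * e}" "z \<in> {e, -4 * e}" "u \<in> {e, -4 * e}"
        "x + y + z + u = 4 * e" for x y z u
      using that e by auto
    ultimately show ?thesis
      using dk by blast
  qed
  then show thesis using that e by blast
qed

text \<open>Increments are known only modulo \<open>m\<close>. Sums of absolute value at most 60
  differ from a step by at most 75, so \<open>m > 100\<close> turns the congruences into equalities
  of integers.\<close>

lemma rigid_mod:
  fixes F :: "nat \<Rightarrow> int" and m :: nat
  assumes m: "m > 100"
    and F: "\<And>k s. s \<in> {1, 4, 15} \<Longrightarrow> \<exists>t\<in>steps. int m dvd F (k + s) - F k - t"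
  obtains e where "e \<in> {1, -1}" "\<And>k. int m dvd F k - F 0 - int k * e"
proof -
  have "\<exists>t\<in>steps. int m dvd F (Suc k) - F k - t" for k
    using F[of 1 k] by simp
  then obtain d where d: "\<And>k. d k \<in> steps" and dm: "\<And>k. int m dvd F (Suc k) - F k - d k"
    by metis
  have sum: "int m dvd F (k + n) - F k - (\<Sum>i<n. d (k + i))" for k n
  proof (induction n)
    case (Suc n)
    have "F (k + Suc n) - F k - (\<Sum>i<Suc n. d (k + i)) =
      (F (k + n) - F k - (\<Sum>i<n. d (k + i))) + (F (Suc (k + n)) - F (k + n) - d (k + n))"
      by simp
    then show ?case using Suc dm by (metis dvd_add)
  qed simp
  have lift: "(\<Sum>i<s. d (k + i)) \<in> steps"
    if s: "s \<in> {1, 4, 15}" and bd: "\<bar>\<Sum>i<s. d (k + i)\<bar> \<le> 60" for s k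
  proof -
    obtain t where t: "t \<in> steps" "int m dvd F (k + s) - F k - t"
      using F[OF s] by blast
    have "int m dvd (\<Sum>i<s. d (k + i)) - t"
      using dvd_diff[OF t(2) sum[of k s]] by simp
    moreover have "\<bar>(\<Sum>i<s. d (k + i)) - t\<bar> < int m"
      using bd steps_abs_le[OF t(1)] m by linarith
    ultimately have "(\<Sum>i<s. d (k + i)) - t = 0"
      by (metis dvd_imp_le_int leD abs_of_nat)
    then show ?thesis using t(1) by simp
  qed
  have four: "(\<Sum>i<4. d (k + i)) \<in> steps" for k
  proof (rule lift)
    have "\<bar>\<Sum>i<4. d (k + i)\<bar> \<le> (\<Sum>i<(4::nat). 15)"
      by (rule order_trans[OF sum_abs sum_mono]) (use steps_abs_le d in blast)
    then show "\<bar>\<Sum>i<4. d (k + i)\<bar> \<le> 60" by simp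
  qed simp
  then have four': "d k + d (Suc k) + d (k + 2) + d (k + 3) \<in> steps" for k
    using four[of k] by (simp add: eval_nat_numeral)
  \<comment> \<open>The bound 15 per term would give 225 for fifteen terms, too much for
    \<open>lift\<close>; the four-term windows improve it to 4 per term, hence to 60.\<close>
  have "\<bar>d k\<bar> \<le> 4" for k
    using steps_four_window[OF d d d d four'[of k]] by auto
  then have "\<bar>\<Sum>i<15. d (k + i)\<bar> \<le> (\<Sum>i<(15::nat). 4)" for k
    by (intro order_trans[OF sum_abs sum_mono]) blast
  then have fifteen: "(\<Sum>i<15. d (k + i)) \<in> steps" for k
    by (intro lift) simp_all
  obtain e where e: "e \<in> {1, -1}" "\<And>k. d k = e"
    using steps_rigid[OF d four' fifteen] by blast
  show thesis
  proof (rule that[OF e(1)])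
    show "int m dvd F k - F 0 - int k * e" for k
      using sum[of 0 k] by (simp add: e(2))
  qed
qed

section \<open>Cones over circulants and their homomorphisms\<close>

text \<open>
  Vertices below \<open>m\<close> form the circulant on \<open>\<int>/m\<close>, and \<open>m, \<dots>, m + 4\<close> are the apexes.
\<close>

definition cone_adj :: "nat \<Rightarrow> nat \<Rightarrow> nat \<Rightarrow> bool" where
  "cone_adj m i j \<longleftrightarrow> i < m + 5 \<and> j < m + 5 \<and> i \<noteq> j \<and>
     (i < m \<longrightarrow> j < m \<longrightarrow> (\<exists>s\<in>steps. int m dvd int i - int j - s))"

lemma cone_adj_sym: "cone_adj m i j \<Longrightarrow> cone_adj m j i"
  unfolding cone_adj_def
  by (metis (no_types, lifting) steps_uminus dvd_minus_iff minus_diff_eq diff_minus_eq_add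
      add_diff_eq diff_diff_eq2 add.commute uminus_add_conv_diff)

lemma cone_adj_shift:
  assumes n: "n > 100" and s: "s \<in> {1, 4, 15}"
  shows "cone_adj n ((k + s) mod n) (k mod n)"
proof -
  have eq: "int n dvd int ((k + s) mod n) - int (k mod n) - int s"
  proof -
    have "int ((k + s) mod n) mod int n = (int k + int s) mod int n"
      by (simp add: zmod_int)
    then have "(int ((k + s) mod n) - int (k mod n) - int s) mod int n
      = ((int k + int s) - int k - int s) mod int n"
      by (metis mod_diff_cong mod_mod_trivial zmod_int)
    then show ?thesis by (simp add: dvd_eq_mod_eq_0)
  qed
  have "(k + s) mod n \<noteq> k mod n"
  proof
    assume "(k + s) mod n = k mod n"
    then have "int n dvd int s" using eq by simp
    then have "n dvd s" by presburger
    then show False using s n by (auto dest: dvd_imp_le)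
  qed
  moreover have "int s \<in> steps" using s by (auto simp: steps_def)
  moreover have "(k + s) mod n < n" "k mod n < n" using n by auto
  ultimately show ?thesis using eq unfolding cone_adj_def by (metis trans_less_add1)
qed

text \<open>The three differences cancel, so the steps of a triangle sum to a multiple of
  \<open>m\<close> of absolute value at most 45, that is, to 0.\<close>

lemma cone_triangle_free:
  assumes m: "m > 100" and "cone_adj m i j" "cone_adj m j k" "cone_adj m k i"
  shows "i \<ge> m \<or> j \<ge> m \<or> k \<ge> m"
proof (rule ccontr)
  assume "\<not> ?thesis"
  then obtain a b c where abc: "a \<in> steps" "b \<in> steps" "c \<in> steps"
    and dvd: "int m dvd int i - int j - a" "int m dvd int j - int k - b" "int m dvd int k - int i - c"
    using assms unfolding cone_adj_def by (metis not_le_imp_less)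
  have "int m dvd (int i - int j - a) + (int j - int k - b) + (int k - int i - c)"
    by (intro dvd_add dvd)
  then have "int m dvd - (a + b + c)" by (simp add: algebra_simps)
  then have "int m dvd a + b + c" by (simp only: dvd_minus_iff)
  moreover have "\<bar>a + b + c\<bar> < int m"
    using steps_abs_le[OF abc(1)] steps_abs_le[OF abc(2)] steps_abs_le[OF abc(3)] m by linarith
  ultimately have "a + b + c = 0"
    by (metis dvd_imp_le_int leD abs_of_nat)
  then show False using steps_triangle_free[OF abc] by simp
qed

lemma cone_adj_irrefl: "\<not> cone_adj m i i"
  by (simp add: cone_adj_def)

lemma cone_adj_apex:
  assumes "n \<le> a" "a < n + 5" "i < n + 5" "i \<noteq> a"
  shows "cone_adj n a i" "cone_adj n i a"
  using assms by (auto simp: cone_adj_def)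

text \<open>
  Six colours suffice for the neighbourhood of a cycle vertex in the target (one for its
  cycle neighbours, five for the apexes), but the other four apexes and the 5-cycle
  \<open>0, 1, 2, 3, 4\<close> of the source need seven.
\<close>

lemma cone_hom_apex:
  fixes h :: "nat \<Rightarrow> nat"
  assumes n: "n > 100" and m: "m > 100"
    and hom: "\<And>i j. cone_adj n i j \<Longrightarrow> cone_adj m (h i) (h j)"
    and a: "n \<le> a" "a < n + 5"
  shows "m \<le> h a"
proof (rule ccontr)
  assume "\<not> m \<le> h a"
  then have ha: "h a < m" by simp
  define col where "col i = (if h i < m then 0 else Suc (h i - m))" for i
  have col_le: "col i \<le> 5" if "i < n + 5" "i \<noteq> a" for i
    using hom[OF cone_adj_apex(1)[OF a that]] by (auto simp: col_def cone_adj_def)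
  have col_ne: "col i \<noteq> col j" if "cone_adj n i j" "i \<noteq> a" "j \<noteq> a" for i j
  proof
    assume eq: "col i = col j"
    have ij: "i < n + 5" "j < n + 5" using that(1) by (auto simp: cone_adj_def)
    have adj: "cone_adj m (h a) (h i)" "cone_adj m (h i) (h j)" "cone_adj m (h j) (h a)"
      using hom cone_adj_apex[OF a] ij that by blast+
    \<comment> \<open>If both had colour 0, they would form a triangle with \<open>h a\<close>
      inside the circulant.\<close>
    have "h i \<ge> m \<or> h j \<ge> m"
      using cone_triangle_free[OF m adj] ha by linarith
    then have "h i = h j" using eq by (auto simp: col_def split: if_splits)
    then show False using adj(2) cone_adj_irrefl by metis
  qed
  let ?A = "{n..<n + 5} - {a}"
  have "inj_on col ?A"
    by (rule inj_onI, rule ccontr) (use col_ne cone_adj_apex(1) in auto)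
  then have "card (col ` ?A) = 4"
    using a by (simp add: card_image)
  moreover have "col ` ?A \<subseteq> {..5}" using col_le by (intro image_subsetI) simp
  ultimately have "card ({..5} - col ` ?A) = 2"
    by (simp add: card_Diff_subset)
  then obtain p q where pq: "{..5} - col ` ?A = {p, q}"
    unfolding card_2_iff by blast
  have two: "col i = p \<or> col i = q" if "i < n" for i
  proof -
    have "col i \<noteq> col b" if "b \<in> ?A" for b
      using col_ne[of i b] cone_adj_apex(2)[of n b i] that \<open>i < n\<close> a by auto
    then have "col i \<notin> col ` ?A" by blast
    then have "col i \<in> {..5} - col ` ?A" using col_le[of i] that a by simp
    then show ?thesis unfolding pq by simp
  qed
  have cyc: "cone_adj n 1 0" "cone_adj n 2 1" "cone_adj n 3 2" "cone_adj n 4 3" "cone_adj n 4 0"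
    using cone_adj_shift[OF n, of 1 0] cone_adj_shift[OF n, of 1 1] cone_adj_shift[OF n, of 1 2]
      cone_adj_shift[OF n, of 1 3] cone_adj_shift[OF n, of 4 0] n
    by (simp_all add: eval_nat_numeral)
  show False
    using col_ne[OF cyc(1)] col_ne[OF cyc(2)] col_ne[OF cyc(3)] col_ne[OF cyc(4)] col_ne[OF cyc(5)]
      two[of 0] two[of 1] two[of 2] two[of 3] two[of 4] n a by auto
qed

text \<open>The five apexes are mapped injectively to apexes and so exhaust them; the other
  vertices, adjacent to every apex, must land in the circulant. There the map is rigid, and closing
  up after \<open>n\<close> unit steps forces \<open>m dvd n\<close>.\<close>

lemma cone_hom_dvd:
  fixes h :: "nat \<Rightarrow> nat"
  assumes n: "n > 100" and m: "m > 100"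
    and hom: "\<And>i j. cone_adj n i j \<Longrightarrow> cone_adj m (h i) (h j)"
  shows "m dvd n"
proof -
  let ?A = "{n..<n + 5}" and ?B = "{m..<m + 5}"
  have lt: "h i < m + 5" if "i < n + 5" for i
  proof (cases "i = n")
    case True
    then show ?thesis using hom[OF cone_adj_apex(1), of n "Suc n"] by (simp add: cone_adj_def)
  next
    case False
    then show ?thesis using hom[OF cone_adj_apex(1), of n i] that by (simp add: cone_adj_def)
  qed
  have "inj_on h ?A"
  proof (rule inj_onI, rule ccontr)
    fix a b assume "a \<in> ?A" "b \<in> ?A" "h a = h b" "a \<noteq> b"
    then show False using hom[OF cone_adj_apex(1), of a b] cone_adj_irrefl by auto
  qed
  then have "card (h ` ?A) = 5" by (simp add: card_image)
  moreover have "h ` ?A \<subseteq> ?B"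
    using lt cone_hom_apex[OF n m hom] by auto
  ultimately have img: "h ` ?A = ?B"
    by (intro card_subset_eq) auto
  have base: "h i < m" if "i < n" for i
  proof (rule ccontr)
    assume "\<not> h i < m"
    then have "h i \<in> h ` ?A" unfolding img using lt[of i] that by simp
    then obtain a where "a \<in> ?A" "h i = h a" by blast
    then show False
      using hom[OF cone_adj_apex(2), of a i] that cone_adj_irrefl by auto
  qed
  define F where "F k = int (h (k mod n))" for k
  have "\<exists>t\<in>steps. int m dvd F (k + s) - F k - t" if "s \<in> {1, 4, 15}" for k s
    using hom[OF cone_adj_shift[OF n that]] base[of "(k + s) mod n"] base[of "k mod n"] n
    by (simp add: cone_adj_def F_def)
  then obtain e where e: "e \<in> {1, -1}" "\<And>k. int m dvd F k - F 0 - int k * e"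
    using rigid_mod[OF m, of F] by metis
  have "int m dvd - (int n * e)" using e(2)[of n] by (simp add: F_def)
  then have "int m dvd int n" using e(1) by auto
  then show ?thesis by simp
qed

definition cone_mod :: "nat \<Rightarrow> nat \<Rightarrow> nat \<Rightarrow> nat" where
  "cone_mod n m i = (if i < n then i mod m else i - n + m)"

text \<open>Differences survive reduction modulo a divisor, and a step is nonzero and smaller than
  \<open>m\<close>, so adjacent vertices stay distinct. This is the converse of
  \<open>cone_hom_dvd\<close>.\<close>

lemma cone_adj_cone_mod:
  assumes m: "m > 100" and dvd: "m dvd n" and adj: "cone_adj n i j"
  shows "cone_adj m (cone_mod n m i) (cone_mod n m j)"
proof (cases "i < n \<and> j < n")
  case True
  then obtain s where s: "s \<in> steps" "int n dvd int i - int j - s"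
    using adj by (auto simp: cone_adj_def)
  have ms: "int m dvd int i - int j - s"
    using s(2) dvd by (meson dvd_trans of_nat_dvd_iff)
  have "(int (i mod m) - int (j mod m) - s) mod int m = (int i - int j - s) mod int m"
    by (metis mod_diff_cong mod_mod_trivial zmod_int)
  then have eq: "int m dvd int (i mod m) - int (j mod m) - s"
    using ms by (simp add: dvd_eq_mod_eq_0)
  have "i mod m \<noteq> j mod m"
  proof
    assume "i mod m = j mod m"
    then have "int m dvd s" using eq by simp
    moreover have "s \<noteq> 0" "\<bar>s\<bar> < int m" using s(1) m by (auto simp: steps_def)
    ultimately show False by (metis dvd_imp_le_int leD abs_of_nat)
  qed
  then show ?thesis
    using True s(1) eq m by (auto simp: cone_adj_def cone_mod_def trans_less_add1)
next
  case False
  have low: "cone_mod n m k < m" if "k < n" for k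
    using that m by (simp add: cone_mod_def)
  have high: "m \<le> cone_mod n m k \<and> cone_mod n m k < m + 5 \<and> cone_mod n m k + n = k + m"
    if "n \<le> k" "k < n + 5" for k
    using that unfolding cone_mod_def by (simp, linarith)
  have ij: "i < n + 5" "j < n + 5" "i \<noteq> j" using adj by (auto simp: cone_adj_def)
  have "cone_mod n m i < m + 5" "cone_mod n m j < m + 5"
    using low high ij by (meson not_le_imp_less trans_less_add1)+
  moreover have "\<not> (cone_mod n m i < m \<and> cone_mod n m j < m)"
    using False high ij by (meson not_le)
  moreover have "cone_mod n m i \<noteq> cone_mod n m j"
    using False low[of i] low[of j] high[of i] high[of j] ij by linarith
  ultimately show ?thesis unfolding cone_adj_def by blast
qed

section \<open>Disjoint unions of cones and cut-continuous maps\<close>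

text \<open>Vertex \<open>i\<close> of the cone with modulus \<open>m\<close> is encoded as \<open>prod_encode (m, i)\<close>.\<close>

definition cone_sum_adj :: "nat set \<Rightarrow> nat \<Rightarrow> nat \<Rightarrow> bool" where
  "cone_sum_adj M u v \<longleftrightarrow> fst (prod_decode u) \<in> M \<and> fst (prod_decode v) = fst (prod_decode u) \<and>
     cone_adj (fst (prod_decode u)) (snd (prod_decode u)) (snd (prod_decode v))"

text \<open>Ordering the ends gives each edge a single code. Numbers that encode no cone vertex are
  isolated vertices, so \<open>N\<close> can be enlarged freely once the cones fit.\<close>

definition cone_sum :: "nat set \<Rightarrow> nat \<Rightarrow> (nat, nat) graph" where
  "cone_sum M N =
     \<lparr>verts = {..<N},
      edges = {prod_encode (u, v) |u v. u < v \<and> v < N \<and> cone_sum_adj M u v},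
      ends = (\<lambda>e. {fst (prod_decode e), snd (prod_decode e)})\<rparr>"

lemma cone_sum_adj_sym: "cone_sum_adj M u v \<Longrightarrow> cone_sum_adj M v u"
  by (auto simp: cone_sum_adj_def cone_adj_sym)

lemma cone_sum_adj_neq: "cone_sum_adj M u v \<Longrightarrow> u \<noteq> v"
  by (auto simp: cone_sum_adj_def cone_adj_irrefl)

lemma verts_cone_sum [simp]: "verts (cone_sum M N) = {..<N}"
  by (simp add: cone_sum_def)

lemma cone_sum_edgeE:
  assumes "e \<in> edges (cone_sum M N)"
  obtains u v where "e = prod_encode (u, v)" "u < v" "v < N" "cone_sum_adj M u v"
    "ends (cone_sum M N) e = {u, v}"
  using assms by (auto simp: cone_sum_def)

lemma cone_sum_edgeI:
  assumes "cone_sum_adj M u v" "u < N" "v < N"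
  obtains e where "e = prod_encode (min u v, max u v)" "e \<in> edges (cone_sum M N)"
    "ends (cone_sum M N) e = {u, v}"
proof
  let ?e = "prod_encode (min u v, max u v)"
  have "cone_sum_adj M (min u v) (max u v)" "min u v < max u v" "max u v < N"
    using assms cone_sum_adj_sym[OF assms(1)] cone_sum_adj_neq[OF assms(1)]
    by (auto simp: min_def max_def)
  then show "?e \<in> edges (cone_sum M N)" unfolding cone_sum_def by auto
  show "ends (cone_sum M N) ?e = {u, v}"
    by (auto simp: cone_sum_def min_def max_def)
qed simp

lemma finite_loopless_cone_sum: "finite_loopless_graph (cone_sum M N)"
proof -
  have "edges (cone_sum M N) \<subseteq> prod_encode ` ({..<N} \<times> {..<N})"
    by (auto elim!: cone_sum_edgeE)
  then have "finite (edges (cone_sum M N))"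
    by (rule finite_subset) simp
  moreover have "ends (cone_sum M N) e \<subseteq> {..<N} \<and> card (ends (cone_sum M N) e) = 2"
    if e: "e \<in> edges (cone_sum M N)" for e
  proof -
    obtain u v where "u < v" "v < N" "ends (cone_sum M N) e = {u, v}"
      by (rule cone_sum_edgeE[OF e])
    then show ?thesis by simp
  qed
  ultimately show ?thesis by (simp add: finite_loopless_graph_def)
qed

text \<open>A homomorphism acts on edges and pulls the cut of \<open>Y\<close> back to the cut of
  the preimage of \<open>Y\<close>; \<open>bound\<close> keeps the images of edges inside the
  target.\<close>

lemma cone_sum_hom_cc_le:
  assumes hom: "\<And>u v. cone_sum_adj M u v \<Longrightarrow> cone_sum_adj M' (\<phi> u) (\<phi> v)"
    and bound: "\<And>u v. cone_sum_adj M' u v \<Longrightarrow> u < N'"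
  shows "cone_sum M N \<preceq>cc cone_sum M' N'"
proof -
  let ?G = "cone_sum M N" and ?H = "cone_sum M' N'"
  define f where "f e = (let u = \<phi> (fst (prod_decode e)); v = \<phi> (snd (prod_decode e))
    in prod_encode (min u v, max u v))" for e
  have edge: "\<exists>u v. ends ?G e = {u, v} \<and> u < N \<and> v < N \<and> f e \<in> edges ?H \<and>
      ends ?H (f e) = {\<phi> u, \<phi> v} \<and> \<phi> u < N' \<and> \<phi> v < N'"
    if e: "e \<in> edges ?G" for e
  proof -
    obtain u v where uv: "e = prod_encode (u, v)" "u < v" "v < N" "cone_sum_adj M u v"
      "ends ?G e = {u, v}"
      by (rule cone_sum_edgeE[OF e])
    have adj: "cone_sum_adj M' (\<phi> u) (\<phi> v)" using hom uv(4) .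
    have lt: "\<phi> u < N'" "\<phi> v < N'" using bound adj cone_sum_adj_sym by blast+
    have "f e = prod_encode (min (\<phi> u) (\<phi> v), max (\<phi> u) (\<phi> v))"
      by (simp add: f_def uv(1) Let_def)
    then have "f e \<in> edges ?H" "ends ?H (f e) = {\<phi> u, \<phi> v}"
      using cone_sum_edgeI[OF adj lt] by metis+
    then show ?thesis using uv lt by (intro exI[of _ u] exI[of _ v]) simp
  qed
  have "is_cut ?G {e \<in> edges ?G. f e \<in> C}" if cut: "is_cut ?H C" for C
  proof -
    obtain Y where C: "C = edge_boundary ?H Y" using cut by (auto simp: is_cut_def)
    let ?X = "{u \<in> verts ?G. \<phi> u \<in> Y}"
    have "f e \<in> C \<longleftrightarrow> e \<in> edge_boundary ?G ?X" if e: "e \<in> edges ?G" for e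
    proof -
      obtain u v where uv: "ends ?G e = {u, v}" "u < N" "v < N" "f e \<in> edges ?H"
        "ends ?H (f e) = {\<phi> u, \<phi> v}" "\<phi> u < N'" "\<phi> v < N'"
        using edge[OF e] by blast
      have "f e \<in> C \<longleftrightarrow> (\<phi> u \<in> Y) \<noteq> (\<phi> v \<in> Y)"
        unfolding C using uv by (intro edge_boundary_iff) auto
      also have "\<dots> \<longleftrightarrow> (u \<in> ?X) \<noteq> (v \<in> ?X)" using uv by simp
      also have "\<dots> \<longleftrightarrow> e \<in> edge_boundary ?G ?X"
        using uv e by (intro edge_boundary_iff[symmetric]) auto
      finally show ?thesis .
    qed
    then have "{e \<in> edges ?G. f e \<in> C} = edge_boundary ?G ?X"
      by (auto simp: edge_boundary_def)
    then show ?thesis unfolding is_cut_def by (metis (no_types, lifting) mem_Collect_eq subsetI)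
  qed
  moreover have "f \<in> edges ?G \<rightarrow> edges ?H" using edge by blast
  ultimately show ?thesis unfolding cc_le_def cut_continuous_def by blast
qed

lemma cone_sum_le_if_dvd:
  assumes M': "\<And>m. m \<in> M' \<Longrightarrow> m > 100"
    and bound: "\<And>m i. m \<in> M' \<Longrightarrow> i < m + 5 \<Longrightarrow> prod_encode (m, i) < N'"
    and dvd: "\<And>n. n \<in> M \<Longrightarrow> \<exists>m\<in>M'. m dvd n"
  shows "cone_sum M N \<preceq>cc cone_sum M' N'"
proof -
  obtain r where r: "\<And>n. n \<in> M \<Longrightarrow> r n \<in> M' \<and> r n dvd n"
    using dvd by metis
  define \<phi> where "\<phi> u = (let n = fst (prod_decode u); i = snd (prod_decode u)
    in prod_encode (r n, cone_mod n (r n) i))" for u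
  show ?thesis
  proof (rule cone_sum_hom_cc_le)
    show "cone_sum_adj M' (\<phi> u) (\<phi> v)" if "cone_sum_adj M u v" for u v
      using that r[of "fst (prod_decode u)"] M'
        cone_adj_cone_mod[of "r (fst (prod_decode u))" "fst (prod_decode u)"
          "snd (prod_decode u)" "snd (prod_decode v)"]
      unfolding cone_sum_adj_def \<phi>_def Let_def by simp
    show "u < N'" if "cone_sum_adj M' u v" for u v
    proof -
      have "prod_encode (fst (prod_decode u), snd (prod_decode u)) < N'"
        using that by (intro bound) (auto simp: cone_sum_adj_def cone_adj_def)
      then show ?thesis by simp
    qed
  qed
qed

text \<open>On the cone of \<open>n\<close> the potential yields a homomorphism \<open>h\<close>
  into the union. As the apex \<open>n\<close> is adjacent to the rest of the cone, \<open>h\<close>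
  stays in one component, and \<open>cone_hom_dvd\<close> applies to it.\<close>

lemma dvd_if_cone_sum_le:
  assumes M: "\<And>n. n \<in> M \<Longrightarrow> n > 100" and M': "\<And>m. m \<in> M' \<Longrightarrow> m > 100"
    and bound: "\<And>n i. n \<in> M \<Longrightarrow> i < n + 5 \<Longrightarrow> prod_encode (n, i) < N"
    and le: "cone_sum M N \<preceq>cc cone_sum M' N'" and n: "n \<in> M"
  shows "\<exists>m\<in>M'. m dvd n"
proof -
  let ?H = "cone_sum M' N'"
  obtain f where f: "cut_continuous (cone_sum M N) ?H f"
    using le by (auto simp: cc_le_def)
  obtain g where g: "\<And>e u v. e \<in> edges (cone_sum M N) \<Longrightarrow> ends (cone_sum M N) e = {u, v} \<Longrightarrow>
      sym_diff (g u) (g v) = ends ?H (f e)"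
    using cut_continuous_potential[OF f finite_loopless_cone_sum finite_loopless_cone_sum] by blast
  define B where "B i = g (prod_encode (n, i))" for i
  have B: "\<exists>u v. sym_diff (B i) (B j) = {u, v} \<and> cone_sum_adj M' u v" if ij: "cone_adj n i j" for i j
  proof -
    have lt: "prod_encode (n, i) < N" "prod_encode (n, j) < N"
      using bound n ij by (auto simp: cone_adj_def)
    have "cone_sum_adj M (prod_encode (n, i)) (prod_encode (n, j))"
      using ij n by (simp add: cone_sum_adj_def)
    then obtain e where e: "e \<in> edges (cone_sum M N)"
      "ends (cone_sum M N) e = {prod_encode (n, i), prod_encode (n, j)}"
      using lt by (rule cone_sum_edgeI)
    then have "f e \<in> edges ?H" using f by (auto simp: cut_continuous_def)
    then obtain u v where "cone_sum_adj M' u v" "ends ?H (f e) = {u, v}"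
      by (rule cone_sum_edgeE)
    then show ?thesis using g[OF e] unfolding B_def by metis
  qed
  have B2: "card (sym_diff (B i) (B j)) = 2" if "cone_adj n i j" for i j
    using B[OF that] cone_sum_adj_neq by fastforce
  obtain A where A1: "\<And>k. k < 5 \<Longrightarrow> \<exists>h. sym_diff A (B (n + k)) = {h}"
    and A2: "\<And>C. (\<And>k. k < 5 \<Longrightarrow> card (sym_diff C (B (n + k))) = 2) \<Longrightarrow> \<exists>h. sym_diff A C = {h}"
  proof (rule five_clique_star[of "\<lambda>k. B (n + k)"])
    show "card (sym_diff (B (n + i)) (B (n + j))) = 2" if "i < 5" "j < 5" "i \<noteq> j" for i j
      using that by (intro B2 cone_adj_apex) auto
  qed blast
  have "\<exists>h. sym_diff A (B i) = {h}" if "i < n + 5" for i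
  proof (cases "i < n")
    case True
    then show ?thesis by (intro A2 B2 cone_adj_apex) auto
  next
    case False
    then show ?thesis using A1[of "i - n"] that by simp
  qed
  then obtain h where h: "\<And>i. i < n + 5 \<Longrightarrow> sym_diff A (B i) = {h i}" by metis
  have hom: "cone_sum_adj M' (h i) (h j)" if ij: "cone_adj n i j" for i j
  proof -
    obtain u v where uv: "sym_diff (B i) (B j) = {u, v}" "cone_sum_adj M' u v"
      using B[OF ij] by blast
    \<comment> \<open>The fixed set \<open>A\<close> cancels, which leaves \<open>h i\<close> and
      \<open>h j\<close> as the ends of the image edge.\<close>
    have "sym_diff (B i) (B j) = sym_diff (sym_diff A (B i)) (sym_diff A (B j))" by auto
    also have "\<dots> = sym_diff {h i} {h j}"
      using h ij by (simp add: cone_adj_def)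
    finally have eq: "sym_diff {h i} {h j} = {u, v}" using uv(1) by simp
    then have "h i \<noteq> h j" by (metis Diff_cancel Un_absorb insert_not_empty)
    then have "sym_diff {h i} {h j} = {h i, h j}" by auto
    then have "{h i, h j} = {u, v}" using eq by simp
    then show ?thesis using uv(2) cone_sum_adj_sym by (auto simp: doubleton_eq_iff)
  qed
  define m where "m = fst (prod_decode (h n))"
  have comp: "fst (prod_decode (h i)) = m" if "i < n + 5" for i
    using hom[OF cone_adj_apex(1), of n i] that by (cases "i = n") (auto simp: m_def cone_sum_adj_def)
  have "cone_sum_adj M' (h n) (h (Suc n))"
    by (intro hom cone_adj_apex) auto
  then have m: "m \<in> M'" by (simp add: m_def cone_sum_adj_def)
  have "m dvd n"
  proof (rule cone_hom_dvd)
    show "cone_adj m (snd (prod_decode (h i))) (snd (prod_decode (h j)))" if "cone_adj n i j" for i j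
      using hom[OF that] comp[of i] that by (simp add: cone_sum_adj_def cone_adj_def)
  qed (use M M' n m in auto)
  then show ?thesis using m by blast
qed

section \<open>Countable orders as finite sets under divisibility\<close>

text \<open>
  Split \<open>le\<close> along an enumeration \<open>e\<close> of \<open>P\<close>. Going up in \<open>le\<close> and down in \<open>e\<close>, each element
  has finitely many successors, so divisibility of products of primes encodes this part; going
  down in \<open>le\<close> and in \<open>e\<close>, the finite sets \<open>M x\<close> encode the rest.
\<close>

lemma countable_order_dvd_sets:
  fixes P :: "'a set" and le :: "'a rel"
  assumes P: "countable P" and po: "partial_order_on P le"
  obtains M :: "'a \<Rightarrow> nat set" where
    "\<And>x. x \<in> P \<Longrightarrow> finite (M x)" "\<And>x n. x \<in> P \<Longrightarrow> n \<in> M x \<Longrightarrow> n > b"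
    "\<And>x y. x \<in> P \<Longrightarrow> y \<in> P \<Longrightarrow> (x, y) \<in> le \<longleftrightarrow> (\<forall>n\<in>M x. \<exists>m\<in>M y. m dvd n)"
proof -
  have refl: "(x, x) \<in> le" if "x \<in> P" for x
    using po that by (auto simp: partial_order_on_def preorder_on_def refl_on_def)
  have trans: "(x, z) \<in> le" if "(x, y) \<in> le" "(y, z) \<in> le" for x y z
    using po that by (meson partial_order_on_def preorder_on_def transD)
  define e where "e = to_nat_on P"
  have e: "inj_on e P" unfolding e_def using P by (rule inj_on_to_nat_on)
  have fin: "finite {x \<in> P. Q x \<and> e x \<le> k}" for Q k
  proof (rule finite_imageD)
    show "finite (e ` {x \<in> P. Q x \<and> e x \<le> k})"
      by (rule finite_subset[of _ "{..k}"]) auto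
    show "inj_on e {x \<in> P. Q x \<and> e x \<le> k}"
      using e by (rule inj_on_subset) auto
  qed
  \<comment> \<open>Primes above \<open>b\<close> ensure \<open>L w > b\<close>, since the prime of
    \<open>w\<close> itself divides \<open>L w\<close>.\<close>
  have "infinite ({q::nat. prime q} - {..b})"
    using primes_infinite by (simp add: Diff_infinite_finite)
  then obtain p :: "nat \<Rightarrow> nat" where p: "inj p" "range p \<subseteq> {q. prime q} - {..b}"
    using infinite_countable_subset by blast
  have prime: "prime (p k)" and p_gt: "p k > b" for k
    using subsetD[OF p(2) rangeI[of p k]] by simp_all
  define up where "up w = {y \<in> P. (w, y) \<in> le \<and> e y \<le> e w}" for w
  define L where "L w = (\<Prod>y\<in>up w. p (e y))" for w
  have fin_up: "finite (up w)" for w unfolding up_def by (rule fin)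
  have self: "w \<in> up w" if "w \<in> P" for w using that refl by (simp add: up_def)
  have p_dvd: "p (e w) dvd L w" if "w \<in> P" for w
    unfolding L_def using fin_up self[OF that] by (rule dvd_prodI)
  have L_gt: "L w > b" if "w \<in> P" for w
  proof -
    have "L w > 0" unfolding L_def using prime by (intro prod_pos prime_gt_0_nat)
    then show ?thesis using dvd_imp_le[OF p_dvd[OF that]] p_gt[of "e w"] by linarith
  qed
  have L_dvd: "z \<in> up w" if "z \<in> P" "L z dvd L w" for z w
  proof -
    have "p (e z) dvd (\<Prod>y\<in>up w. p (e y))"
      using p_dvd[OF that(1)] that(2) unfolding L_def by (rule dvd_trans)
    then obtain y where y: "y \<in> up w" "p (e z) dvd p (e y)"
      by (auto simp only: prime_dvd_prod_iff[OF fin_up prime])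
    then have "p (e z) = p (e y)" using primes_dvd_imp_eq prime by blast
    then have "e z = e y" by (rule injD[OF p(1)])
    then have "z = y" using e that(1) y(1) by (auto simp: up_def dest: inj_onD)
    then show ?thesis using y(1) by simp
  qed
  have dvd_L: "L z dvd L w" if "z \<in> up w" for z w
    unfolding L_def
  proof (rule prod_dvd_prod_subset[OF fin_up])
    show "up z \<subseteq> up w" using that trans unfolding up_def by fastforce
  qed
  define D where "D x = {w \<in> P. (w, x) \<in> le \<and> e w \<le> e x}" for x
  show thesis
  proof (rule that[of "\<lambda>x. L ` D x"])
    show "finite (L ` D x)" for x
      unfolding D_def by (rule finite_imageI, rule fin)
    show "n > b" if "n \<in> L ` D x" for x n
      using that L_gt by (auto simp: D_def)
    show "(x, y) \<in> le \<longleftrightarrow> (\<forall>n\<in>L ` D x. \<exists>m\<in>L ` D y. m dvd n)" if x: "x \<in> P" and y: "y \<in> P" for x y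
    proof
      assume xy: "(x, y) \<in> le"
      have "\<exists>v\<in>D y. L v dvd L w" if w: "w \<in> D x" for w
      \<comment> \<open>Either \<open>w\<close> is enumerated no later than \<open>y\<close> and is
        its own witness in \<open>D y\<close>, or \<open>y\<close> lies in \<open>up w\<close> and
        \<open>L y\<close> divides \<open>L w\<close>.\<close>
      proof (cases "e w \<le> e y")
        case True
        then have "w \<in> D y" using w xy trans by (auto simp: D_def)
        then show ?thesis by (intro bexI[of _ w]) simp_all
      next
        case False
        then have "y \<in> up w" using w xy trans y by (auto simp: D_def up_def)
        moreover have "y \<in> D y" using y refl by (simp add: D_def)
        ultimately show ?thesis using dvd_L by blast
      qed
      then show "\<forall>n\<in>L ` D x. \<exists>m\<in>L ` D y. m dvd n" by blast
    next
      assume "\<forall>n\<in>L ` D x. \<exists>m\<in>L ` D y. m dvd n"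
      \<comment> \<open>Testing \<open>L x\<close> suffices: the resulting \<open>v\<close> is above
        \<open>x\<close> by divisibility and below \<open>y\<close> as a member of
        \<open>D y\<close>.\<close>
      moreover have "x \<in> D x" using x refl by (simp add: D_def)
      ultimately obtain v where v: "v \<in> D y" "L v dvd L x" by blast
      then have "v \<in> up x" using L_dvd by (simp add: D_def)
      then show "(x, y) \<in> le" using v(1) trans by (auto simp: D_def up_def)
    qed
  qed
qed

section \<open>Representation of the order by padded unions of cones\<close>

theorem corollary1:
  fixes P :: "'a set" and le :: "'a rel"
  assumes "countable P" and "partial_order_on P le"
  shows "\<exists>G :: 'a \<Rightarrow> (nat, nat) graph.
           (\<forall>x \<in> P. finite_loopless_graph (G x)) \<and>
           inj_on G P \<and>
           (\<forall>x \<in> P. \<forall>y \<in> P. graph_iso (G x) (G y) \<longrightarrow> x = y) \<and>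
           (\<forall>x \<in> P. \<forall>y \<in> P. ((x, y) \<in> le \<and> x \<noteq> y) \<longleftrightarrow> G x \<prec>cc G y)"
proof -
  obtain M :: "'a \<Rightarrow> nat set" where fin: "\<And>x. x \<in> P \<Longrightarrow> finite (M x)"
    and M: "\<And>x n. x \<in> P \<Longrightarrow> n \<in> M x \<Longrightarrow> n > 100"
    and le: "\<And>x y. x \<in> P \<Longrightarrow> y \<in> P \<Longrightarrow> (x, y) \<in> le \<longleftrightarrow> (\<forall>n\<in>M x. \<exists>m\<in>M y. m dvd n)"
    using countable_order_dvd_sets[OF assms, of 100] by blast
  have "\<exists>N. \<forall>n\<in>M x. \<forall>i<n + 5. prod_encode (n, i) < N" if "x \<in> P" for x
  proof -
    have "finite (prod_encode ` Sigma (M x) (\<lambda>n. {..<n + 5}))"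
      using fin[OF that] by simp
    then show ?thesis unfolding finite_nat_set_iff_bounded by auto
  qed
  then obtain N where N: "\<And>x n i. x \<in> P \<Longrightarrow> n \<in> M x \<Longrightarrow> i < n + 5 \<Longrightarrow> prod_encode (n, i) < N x"
    by metis
  \<comment> \<open>Isolated vertices make the orders of the graphs pairwise distinct.\<close>
  define K where "K x = prod_encode (N x, to_nat_on P x)" for x
  have K: "prod_encode (n, i) < K x" if "x \<in> P" "n \<in> M x" "i < n + 5" for x n i
    \<comment> \<open>A pair code is at least its first component, so \<open>N x \<le> K x\<close>
      and the cones still fit.\<close>
    using N[OF that] le_prod_encode_1[of "N x" "to_nat_on P x"] by (simp add: K_def)
  have K_inj: "x = y" if "x \<in> P" "y \<in> P" "K x = K y" for x y
    using that inj_on_to_nat_on[OF assms(1)] by (auto simp: K_def prod_encode_eq dest: inj_onD)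
  define G where "G x = cone_sum (M x) (K x)" for x
  have cc: "G x \<preceq>cc G y \<longleftrightarrow> (x, y) \<in> le" if "x \<in> P" "y \<in> P" for x y
  proof
    assume "G x \<preceq>cc G y"
    then have "cone_sum (M x) (K x) \<preceq>cc cone_sum (M y) (K y)" unfolding G_def .
    from dvd_if_cone_sum_le[OF M[OF that(1)] M[OF that(2)] K[OF that(1)] this]
    show "(x, y) \<in> le" unfolding le[OF that] by simp
  next
    assume "(x, y) \<in> le"
    then have "\<exists>m\<in>M y. m dvd n" if "n \<in> M x" for n
      using le[OF \<open>x \<in> P\<close> \<open>y \<in> P\<close>] that by blast
    from cone_sum_le_if_dvd[OF M[OF that(2)] K[OF that(2)] this]
    show "G x \<preceq>cc G y" unfolding G_def by simp
  qed
  have iso: "x = y" if "x \<in> P" "y \<in> P" "graph_iso (G x) (G y)" for x y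
  proof -
    have "card (verts (G x)) = card (verts (G y))"
      using that(3) unfolding graph_iso_def by (metis bij_betw_same_card)
    then show ?thesis using K_inj[OF that(1,2)] by (simp add: G_def)
  qed
  have inj: "inj_on G P"
  proof (rule inj_onI)
    fix x y assume xy: "x \<in> P" "y \<in> P" and "G x = G y"
    then have "verts (G x) = verts (G y)" by simp
    then show "x = y" using K_inj[OF xy] by (simp add: G_def)
  qed
  have anti: "antisym le" using assms(2) by (simp add: partial_order_on_def)
  have refl: "(x, x) \<in> le" if "x \<in> P" for x
    using assms(2) that by (auto simp: partial_order_on_def preorder_on_def refl_on_def)
  have strict: "((x, y) \<in> le \<and> x \<noteq> y) \<longleftrightarrow> G x \<prec>cc G y" if "x \<in> P" "y \<in> P" for x y
    unfolding cc_less_def cc[OF that] cc[OF that(2,1)]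
    using refl[OF that(1)] antisymD[OF anti, of x y] by metis
  show ?thesis
    using finite_loopless_cone_sum inj iso strict by (intro exI[of _ G]) (simp add: G_def)
qed

end
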